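(* Let $M$ be a $\vee e$-$\Gamma$-semigroup, let $a,b\in M$, $\gamma\in\Gamma$ and $m,n\in\mathbb{N}=\{1,2,3,\dots\}$. Then (1) $(a\vee a_\gamma^m\gamma b)_\gamma^m\gamma e=a_\gamma^m\gamma e$; (2) $e\gamma(a\vee b\gamma a_\gamma^n)_\gamma^n=e\gamma a_\gamma^n$.
   Context: A $\Gamma$-semigroup consists of nonempty sets $M$ and $\Gamma$ together with a map $M\times\Gamma\times M\to M$, $(a,\gamma,b)\mapsto a\gamma b$, such that $(a\gamma b)\mu c=a\gamma(b\mu c)$ for all $a,b,c\in M$, $\gamma,\mu\in\Gamma$. A $\vee e$-$\Gamma$-semigroup is a $\Gamma$-semigroup $M$ that is also a join-semilattice (partial order $\le$ with binary supremum $\vee$) with a greatest element $e$, such that $a\gamma(b\vee c)=a\gamma b\vee a\gamma c$ and $(a\vee b)\gamma c=a\gamma c\vee b\gamma c$ for all $a,b,c\in M$, $\gamma\in\Gamma$. Powers: for $a\in M$, $\gamma\in\Gamma$, put $a_\gamma^1:=a$ and, for $m\ge 2$, $a_\gamma^m:=a\gamma a\gamma\cdots\gamma a$ ($m$ copies of $a$ and $m-1$ copies of $\gamma$). *)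

theory Defs
  imports Main
begin

text \<open>
  The sets \<open>M\<close> and \<open>\<Gamma>\<close> are the types \<open>'a\<close> and \<open>'g\<close>; types are nonempty in HOL.
\<close>

locale gamma_semigroup =
  fixes mul :: "'a \<Rightarrow> 'g \<Rightarrow> 'a \<Rightarrow> 'a"  ("(_ \<odot>\<^bsub>_\<^esub> _)" [70, 0, 71] 70)
  assumes mul_assoc: "(a \<odot>\<^bsub>\<gamma>\<^esub> b) \<odot>\<^bsub>\<mu>\<^esub> c = a \<odot>\<^bsub>\<gamma>\<^esub> (b \<odot>\<^bsub>\<mu>\<^esub> c)"

text \<open>
  The greatest element \<open>e\<close> is \<^const>\<open>top\<close>, the join is \<^const>\<open>sup\<close>.
\<close>

locale ve_gamma_semigroup = gamma_semigroup mul
  for mul :: "'a::{semilattice_sup, order_top} \<Rightarrow> 'g \<Rightarrow> 'a \<Rightarrow> 'a"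
    ("(_ \<odot>\<^bsub>_\<^esub> _)" [70, 0, 71] 70) +
  assumes mul_sup_right: "a \<odot>\<^bsub>\<gamma>\<^esub> sup b c = sup (a \<odot>\<^bsub>\<gamma>\<^esub> b) (a \<odot>\<^bsub>\<gamma>\<^esub> c)"
    and mul_sup_left: "sup a b \<odot>\<^bsub>\<gamma>\<^esub> c = sup (a \<odot>\<^bsub>\<gamma>\<^esub> c) (b \<odot>\<^bsub>\<gamma>\<^esub> c)"

text \<open>
  Powers are bracketed to the left. There is no zeroth power, since \<open>M\<close> need not
  contain an identity.
\<close>

fun gpower :: "('a \<Rightarrow> 'g \<Rightarrow> 'a \<Rightarrow> 'a) \<Rightarrow> 'g \<Rightarrow> 'a \<Rightarrow> nat \<Rightarrow> 'a" where
  "gpower mul \<gamma> a 0 = undefined"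
| "gpower mul \<gamma> a (Suc 0) = a"
| "gpower mul \<gamma> a (Suc (Suc m)) = mul (gpower mul \<gamma> a (Suc m)) \<gamma> a"

end

theory Submission
  imports Defs
begin

text \<open>
  With \<open>c = a \<or> a\<^sup>m b\<close>, the elements \<open>a\<^sup>k e\<close> decrease in \<open>k\<close>, so for \<open>k < m\<close> one has
  \<open>c a\<^sup>k e = a\<^sup>k\<^sup>+\<^sup>1 e \<or> a\<^sup>m (b a\<^sup>k e) \<le> a\<^sup>k\<^sup>+\<^sup>1 e\<close>, since the second joinand is at most \<open>a\<^sup>m e\<close>. Induction
  on \<open>k\<close> gives \<open>c\<^sup>m e \<le> a\<^sup>m e\<close>; the converse is monotonicity. The second equation is the first one
  in the opposite semigroup.
\<close>

context gamma_semigroup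
begin

lemma gpower_Suc:
  assumes "1 \<le> k"
  shows "gpower mul \<gamma> a (Suc k) = gpower mul \<gamma> a k \<odot>\<^bsub>\<gamma>\<^esub> a"
  using assms by (cases k) auto

text \<open>\<open>gpower\<close> appends factors on the right; associativity moves the new one to
  the left. This serves both the passage to the opposite semigroup and the peeling of a leftmost
  factor.\<close>

lemma gpower_Suc_left:
  assumes "1 \<le> k"
  shows "gpower mul \<gamma> a (Suc k) = a \<odot>\<^bsub>\<gamma>\<^esub> gpower mul \<gamma> a k"
  using assms
proof (induction k rule: dec_induct)
  case base
  show ?case by simp
next
  case (step k)
  then show ?case
    using gpower_Suc[of "Suc k" \<gamma> a] gpower_Suc[of k \<gamma> a] mul_assoc by simp
qed

lemma gpower_opposite:
  assumes "1 \<le> k"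
  shows "gpower (\<lambda>x \<mu> y. y \<odot>\<^bsub>\<mu>\<^esub> x) \<gamma> a k = gpower mul \<gamma> a k"
  using assms
proof (induction k rule: dec_induct)
  case base
  show ?case by simp
next
  case (step k)
  then show ?case
    using gpower_Suc_left[of k \<gamma> a] by (cases k) auto
qed

end

context ve_gamma_semigroup
begin

lemma mul_mono:
  assumes "a \<le> c" and "b \<le> d"
  shows "a \<odot>\<^bsub>\<gamma>\<^esub> b \<le> c \<odot>\<^bsub>\<gamma>\<^esub> d"
proof -
  have "a \<odot>\<^bsub>\<gamma>\<^esub> b \<le> c \<odot>\<^bsub>\<gamma>\<^esub> b"
    using mul_sup_left[of a c \<gamma> b] assms(1) by (simp add: le_iff_sup)
  also have "\<dots> \<le> c \<odot>\<^bsub>\<gamma>\<^esub> d"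
    using mul_sup_right[of c \<gamma> b d] assms(2) by (simp add: le_iff_sup)
  finally show ?thesis .
qed

lemma gpower_mono:
  assumes "1 \<le> k" and "a \<le> c"
  shows "gpower mul \<gamma> a k \<le> gpower mul \<gamma> c k"
  using assms(1)
proof (induction k rule: dec_induct)
  case base
  show ?case using assms(2) by simp
next
  case (step k)
  then show ?case
    using assms(2) by (simp add: gpower_Suc mul_mono)
qed

text \<open>One extra factor \<open>a\<close> is absorbed by the greatest element, because
  \<open>a\<close> times \<open>top\<close> is at most \<open>top\<close>.\<close>

lemma gpower_mul_top_antimono:
  assumes "1 \<le> k" and "k \<le> m"
  shows "gpower mul \<gamma> a m \<odot>\<^bsub>\<gamma>\<^esub> top \<le> gpower mul \<gamma> a k \<odot>\<^bsub>\<gamma>\<^esub> top"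
  using assms(2)
proof (induction m rule: dec_induct)
  case base
  show ?case by simp
next
  case (step m)
  have "gpower mul \<gamma> a (Suc m) \<odot>\<^bsub>\<gamma>\<^esub> top = gpower mul \<gamma> a m \<odot>\<^bsub>\<gamma>\<^esub> (a \<odot>\<^bsub>\<gamma>\<^esub> top)"
    using assms(1) step.hyps by (simp add: gpower_Suc mul_assoc)
  also have "\<dots> \<le> gpower mul \<gamma> a m \<odot>\<^bsub>\<gamma>\<^esub> top"
    by (simp add: mul_mono)
  finally show ?case using step.IH by simp
qed

text \<open>The outer exponent \<open>k\<close> is kept apart from the \<open>m\<close> inside the
  base, so that induction on \<open>k\<close> leaves the base fixed.\<close>

lemma gpower_sup_mul_top_le:
  assumes "1 \<le> k" and "k \<le> m"
  shows "gpower mul \<gamma> (sup a (gpower mul \<gamma> a m \<odot>\<^bsub>\<gamma>\<^esub> b)) k \<odot>\<^bsub>\<gamma>\<^esub> top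
    \<le> gpower mul \<gamma> a k \<odot>\<^bsub>\<gamma>\<^esub> top" (is "gpower mul \<gamma> ?c k \<odot>\<^bsub>\<gamma>\<^esub> top \<le> _")
proof -
  \<comment> \<open>Stated for arbitrary \<open>x\<close> to serve both cases: the base takes
    \<open>j = 1\<close> and \<open>x = top\<close>, the step takes \<open>j = Suc k\<close> and
    \<open>x\<close> the \<open>k\<close>-th power of \<open>a\<close> times
    \<open>top\<close>.\<close>
  have sup_le: "?c \<odot>\<^bsub>\<gamma>\<^esub> x \<le> gpower mul \<gamma> a j \<odot>\<^bsub>\<gamma>\<^esub> top"
    if "1 \<le> j" "j \<le> m" "a \<odot>\<^bsub>\<gamma>\<^esub> x \<le> gpower mul \<gamma> a j \<odot>\<^bsub>\<gamma>\<^esub> top" for j x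
  proof -
    have "gpower mul \<gamma> a m \<odot>\<^bsub>\<gamma>\<^esub> (b \<odot>\<^bsub>\<gamma>\<^esub> x) \<le> gpower mul \<gamma> a m \<odot>\<^bsub>\<gamma>\<^esub> top"
      by (simp add: mul_mono)
    also have "\<dots> \<le> gpower mul \<gamma> a j \<odot>\<^bsub>\<gamma>\<^esub> top"
      using that by (simp add: gpower_mul_top_antimono)
    finally show ?thesis
      using that(3) by (simp add: mul_sup_left mul_assoc)
  qed
  show ?thesis
    using assms
  proof (induction k rule: dec_induct)
    case base
    then show ?case using sup_le[of 1 top] by simp
  next
    case (step k)
    \<comment> \<open>Splitting off the leftmost \<open>?c\<close> leaves exactly the product
      bounded by the induction hypothesis.\<close>
    then have "gpower mul \<gamma> ?c (Suc k) \<odot>\<^bsub>\<gamma>\<^esub> top = ?c \<odot>\<^bsub>\<gamma>\<^esub> (gpower mul \<gamma> ?c k \<odot>\<^bsub>\<gamma>\<^esub> top)"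
      by (simp add: gpower_Suc_left mul_assoc)
    also have "\<dots> \<le> ?c \<odot>\<^bsub>\<gamma>\<^esub> (gpower mul \<gamma> a k \<odot>\<^bsub>\<gamma>\<^esub> top)"
      using step by (intro mul_mono[OF order_refl]) simp
    \<comment> \<open>The bound \<open>Suc k \<le> m\<close>, carried through the induction, is what
      \<open>sup_le\<close> needs here.\<close>
    also have "\<dots> \<le> gpower mul \<gamma> a (Suc k) \<odot>\<^bsub>\<gamma>\<^esub> top"
      using step by (intro sup_le) (auto simp: gpower_Suc_left mul_assoc)
    finally show ?case .
  qed
qed

lemma gpower_sup_mul_top:
  assumes "1 \<le> m"
  shows "gpower mul \<gamma> (sup a (gpower mul \<gamma> a m \<odot>\<^bsub>\<gamma>\<^esub> b)) m \<odot>\<^bsub>\<gamma>\<^esub> top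
    = gpower mul \<gamma> a m \<odot>\<^bsub>\<gamma>\<^esub> top"
  using assms by (intro antisym gpower_sup_mul_top_le mul_mono gpower_mono) auto

lemma ve_gamma_semigroup_opposite: "ve_gamma_semigroup (\<lambda>x \<mu> y. y \<odot>\<^bsub>\<mu>\<^esub> x)"
  by unfold_locales (simp_all add: mul_assoc mul_sup_left mul_sup_right)

text \<open>Reversing products turns left multiplication by \<open>top\<close> into right
  multiplication, while \<open>gpower_opposite\<close> keeps the powers unchanged.\<close>

lemma top_mul_gpower_sup:
  assumes "1 \<le> n"
  shows "top \<odot>\<^bsub>\<gamma>\<^esub> gpower mul \<gamma> (sup a (b \<odot>\<^bsub>\<gamma>\<^esub> gpower mul \<gamma> a n)) n
    = top \<odot>\<^bsub>\<gamma>\<^esub> gpower mul \<gamma> a n"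
  using ve_gamma_semigroup.gpower_sup_mul_top[OF ve_gamma_semigroup_opposite assms, of \<gamma> a b]
  by (simp add: gpower_opposite[OF assms])

end

theorem lemma3:
  fixes mul :: "'a::{semilattice_sup, order_top} \<Rightarrow> 'g \<Rightarrow> 'a \<Rightarrow> 'a"
      ("(_ \<odot>\<^bsub>_\<^esub> _)" [70, 0, 71] 70)
    and a b :: 'a and \<gamma> :: 'g and m n :: nat
  assumes "ve_gamma_semigroup mul"
    and "m \<ge> 1" and "n \<ge> 1"
  shows "gpower mul \<gamma> (sup a (gpower mul \<gamma> a m \<odot>\<^bsub>\<gamma>\<^esub> b)) m \<odot>\<^bsub>\<gamma>\<^esub> top
           = gpower mul \<gamma> a m \<odot>\<^bsub>\<gamma>\<^esub> top
    \<and> top \<odot>\<^bsub>\<gamma>\<^esub> gpower mul \<gamma> (sup a (b \<odot>\<^bsub>\<gamma>\<^esub> gpower mul \<gamma> a n)) n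
           = top \<odot>\<^bsub>\<gamma>\<^esub> gpower mul \<gamma> a n"
  using assms
  by (intro conjI ve_gamma_semigroup.gpower_sup_mul_top ve_gamma_semigroup.top_mul_gpower_sup)

end
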